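(* Let $(A,\mu_A,\alpha_A,\beta_A)$ and $(B,\mu_B,\alpha_B,\beta_B)$ be two BiHom-Jordan algebras. Then $(A\oplus B,\mu,\alpha,\beta)$ is a BiHom-Jordan algebra, where $$\mu(a_1+b_1,a_2+b_2)=\mu_A(a_1,a_2)+\mu_B(b_1,b_2)\quad\text{for all } a_1,a_2\in A,\ b_1,b_2\in B,$$ and $\alpha(a+b)=\alpha_A(a)+\alpha_B(b)$, $\beta(a+b)=\beta_A(a)+\beta_B(b)$ for all $(a,b)\in A\times B$.
   Context: $\mathbb{K}$ is an algebraically closed field of characteristic $0$; all vector spaces and (multi)linear maps are over $\mathbb{K}$. A BiHom-algebra $(A,\mu,\alpha,\beta)$ is a vector space $A$ with a bilinear map $\mu:A\times A\to A$ and linear maps $\alpha,\beta:A\to A$ with $\alpha\beta=\beta\alpha$. It is multiplicative if $\alpha(\mu(x,y))=\mu(\alpha(x),\alpha(y))$ and $\beta(\mu(x,y))=\mu(\beta(x),\beta(y))$ for all $x,y\in A$. Its BiHom-associator is $as_{\alpha,\beta}(x,y,z)=\mu(\mu(x,y),\beta(z))-\mu(\alpha(x),\mu(y,z))$. A BiHom-Jordan algebra is a multiplicative BiHom-algebra such that for all $x,y\in A$: $\mu(\beta(x),\alpha(y))=\mu(\beta(y),\alpha(x))$ and $as_{\alpha,\beta}\big(\mu(\beta^2(x),\alpha\beta(x)),\alpha^2\beta(y),\alpha^3(x)\big)=0$. *)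

theory Defs
  imports
    "HOL-Analysis.Product_Vector"
    "HOL-Computational_Algebra.Polynomial"
begin

text \<open>
  As in theory \<open>Vector_Spaces\<close>, a vector space is a whole type together with its scalar
  multiplication \<open>scale\<close>, over an arbitrary field \<open>'k\<close>. Bilinear maps are in curried form.
\<close>

locale bihom_algebra = vector_space scale
  for scale :: "'k::field \<Rightarrow> 'a::ab_group_add \<Rightarrow> 'a" +
  fixes \<mu> :: "'a \<Rightarrow> 'a \<Rightarrow> 'a"
    and \<alpha> :: "'a \<Rightarrow> 'a"
    and \<beta> :: "'a \<Rightarrow> 'a"
  assumes mult_linear_left: "\<And>y. Vector_Spaces.linear scale scale (\<lambda>x. \<mu> x y)"
    and mult_linear_right: "\<And>x. Vector_Spaces.linear scale scale (\<lambda>y. \<mu> x y)"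
    and alpha_linear: "Vector_Spaces.linear scale scale \<alpha>"
    and beta_linear: "Vector_Spaces.linear scale scale \<beta>"
    and alpha_beta_commute: "\<alpha> \<circ> \<beta> = \<beta> \<circ> \<alpha>"
begin

definition associator :: "'a \<Rightarrow> 'a \<Rightarrow> 'a \<Rightarrow> 'a"
  where "associator x y z = \<mu> (\<mu> x y) (\<beta> z) - \<mu> (\<alpha> x) (\<mu> y z)"

end

locale multiplicative_bihom_algebra = bihom_algebra +
  assumes alpha_mult: "\<And>x y. \<alpha> (\<mu> x y) = \<mu> (\<alpha> x) (\<alpha> y)"
    and beta_mult: "\<And>x y. \<beta> (\<mu> x y) = \<mu> (\<beta> x) (\<beta> y)"

locale bihom_jordan_algebra = multiplicative_bihom_algebra +
  assumes bihom_commutative: "\<And>x y. \<mu> (\<beta> x) (\<alpha> y) = \<mu> (\<beta> y) (\<alpha> x)"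
    and bihom_jordan_identity:
      "\<And>x y. associator (\<mu> ((\<beta> ^^ 2) x) (\<alpha> (\<beta> x))) ((\<alpha> ^^ 2) (\<beta> y)) ((\<alpha> ^^ 3) x) = 0"

text \<open>
  The direct sum \<open>A \<oplus> B\<close> is the product type with componentwise addition and the scalar
  multiplication \<^const>\<open>module_prod.scale\<close>; the formal sum \<open>a + b\<close> is the pair \<open>(a, b)\<close>.
\<close>

definition direct_sum_mult ::
  "('a \<Rightarrow> 'a \<Rightarrow> 'a) \<Rightarrow> ('b \<Rightarrow> 'b \<Rightarrow> 'b) \<Rightarrow> 'a \<times> 'b \<Rightarrow> 'a \<times> 'b \<Rightarrow> 'a \<times> 'b"
  where "direct_sum_mult \<mu>A \<mu>B = (\<lambda>(a1, b1) (a2, b2). (\<mu>A a1 a2, \<mu>B b1 b2))"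

end

theory Submission
  imports Defs
begin

text \<open>Every operation of the direct sum acts componentwise: \<open>map_prod\<close> for the
  twisting maps, \<open>direct_sum_mult\<close> for the product. The BiHom-Jordan axioms are
  linearity conditions and universally quantified identities in these operations and in subtraction
  and zero, which are componentwise as well. So each axiom for the sum splits into the same axiom
  for A and for B. The proof climbs the hierarchy of structures: linearity of all maps comes from
  \<open>linear_map_prod\<close>, multiplicativity is then read off on pairs, and the Jordan
  identity follows since powers of the twisting maps (\<open>map_prod_funpow\<close>) and the
  associator also split.\<close>

lemma linear_map_prod:
  assumes "Vector_Spaces.linear s1 t1 f" and "Vector_Spaces.linear s2 t2 g"
  shows "Vector_Spaces.linear (module_prod.scale s1 s2) (module_prod.scale t1 t2) (map_prod f g)"
proof -
  interpret f: Vector_Spaces.linear s1 t1 f by fact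
  interpret g: Vector_Spaces.linear s2 t2 g by fact
  interpret s: vector_space_prod s1 s2 ..
  interpret t: vector_space_prod t1 t2 ..
  show ?thesis
    by unfold_locales (auto simp: s.scale_def t.scale_def f.add g.add f.scale g.scale)
qed

lemma direct_sum_mult_Pair [simp]:
  "direct_sum_mult \<mu>A \<mu>B (a1, b1) (a2, b2) = (\<mu>A a1 a2, \<mu>B b1 b2)"
  by (simp add: direct_sum_mult_def)

lemma map_prod_funpow:
  fixes f :: "'a \<Rightarrow> 'a" and g :: "'b \<Rightarrow> 'b"
  shows "map_prod f g ^^ n = map_prod (f ^^ n) (g ^^ n)"
  by (induction n) (auto simp: fun_eq_iff)

text \<open>With one argument fixed, the product on the sum is itself a \<open>map_prod\<close> of
  two linear maps, so bilinearity is again an instance of \<open>linear_map_prod\<close>.\<close>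

lemma bihom_algebra_direct_sum:
  assumes "bihom_algebra scaleA \<mu>A \<alpha>A \<beta>A" and "bihom_algebra scaleB \<mu>B \<alpha>B \<beta>B"
  shows "bihom_algebra (module_prod.scale scaleA scaleB)
           (direct_sum_mult \<mu>A \<mu>B) (map_prod \<alpha>A \<alpha>B) (map_prod \<beta>A \<beta>B)"
proof -
  interpret A: bihom_algebra scaleA \<mu>A \<alpha>A \<beta>A by fact
  interpret B: bihom_algebra scaleB \<mu>B \<alpha>B \<beta>B by fact
  interpret P: vector_space_prod scaleA scaleB ..
  \<comment> \<open>The fixed argument enters through \<open>fst\<close> and \<open>snd\<close>, so
    that the equation holds for an arbitrary \<open>y\<close> and can be used to unfold the
    goal.\<close>
  have left: "(\<lambda>x. direct_sum_mult \<mu>A \<mu>B x y)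
      = map_prod (\<lambda>a. \<mu>A a (fst y)) (\<lambda>b. \<mu>B b (snd y))" for y
    by (cases y) auto
  have right: "direct_sum_mult \<mu>A \<mu>B x = map_prod (\<mu>A (fst x)) (\<mu>B (snd x))" for x
    by (cases x) auto
  show ?thesis
  proof (intro bihom_algebra.intro bihom_algebra_axioms.intro)
    show "vector_space P.scale" ..
    show "map_prod \<alpha>A \<alpha>B \<circ> map_prod \<beta>A \<beta>B = map_prod \<beta>A \<beta>B \<circ> map_prod \<alpha>A \<alpha>B"
      by (simp add: map_prod.comp A.alpha_beta_commute B.alpha_beta_commute)
    show "Vector_Spaces.linear P.scale P.scale (\<lambda>x. direct_sum_mult \<mu>A \<mu>B x y)" for y
      unfolding left by (intro linear_map_prod A.mult_linear_left B.mult_linear_left)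
    show "Vector_Spaces.linear P.scale P.scale (direct_sum_mult \<mu>A \<mu>B x)" for x
      unfolding right by (intro linear_map_prod A.mult_linear_right B.mult_linear_right)
  qed (intro linear_map_prod A.alpha_linear B.alpha_linear A.beta_linear B.beta_linear)+
qed

lemma multiplicative_bihom_algebra_direct_sum:
  assumes "multiplicative_bihom_algebra scaleA \<mu>A \<alpha>A \<beta>A"
    and "multiplicative_bihom_algebra scaleB \<mu>B \<alpha>B \<beta>B"
  shows "multiplicative_bihom_algebra (module_prod.scale scaleA scaleB)
           (direct_sum_mult \<mu>A \<mu>B) (map_prod \<alpha>A \<alpha>B) (map_prod \<beta>A \<beta>B)"
proof -
  interpret A: multiplicative_bihom_algebra scaleA \<mu>A \<alpha>A \<beta>A by fact
  interpret B: multiplicative_bihom_algebra scaleB \<mu>B \<alpha>B \<beta>B by fact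
  interpret bihom_algebra "module_prod.scale scaleA scaleB" "direct_sum_mult \<mu>A \<mu>B"
    "map_prod \<alpha>A \<alpha>B" "map_prod \<beta>A \<beta>B"
    by (intro bihom_algebra_direct_sum A.bihom_algebra_axioms B.bihom_algebra_axioms)
  show ?thesis
    by unfold_locales
      (auto simp: A.alpha_mult B.alpha_mult A.beta_mult B.beta_mult)
qed

theorem proposition3p10:
  fixes scaleA :: "'k::{alg_closed_field, field_char_0} \<Rightarrow> 'a::ab_group_add \<Rightarrow> 'a"
    and scaleB :: "'k \<Rightarrow> 'b::ab_group_add \<Rightarrow> 'b"
    and \<mu>A :: "'a \<Rightarrow> 'a \<Rightarrow> 'a" and \<alpha>A \<beta>A :: "'a \<Rightarrow> 'a"
    and \<mu>B :: "'b \<Rightarrow> 'b \<Rightarrow> 'b" and \<alpha>B \<beta>B :: "'b \<Rightarrow> 'b"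
  assumes "bihom_jordan_algebra scaleA \<mu>A \<alpha>A \<beta>A"
    and "bihom_jordan_algebra scaleB \<mu>B \<alpha>B \<beta>B"
  shows "bihom_jordan_algebra (module_prod.scale scaleA scaleB)
           (direct_sum_mult \<mu>A \<mu>B) (map_prod \<alpha>A \<alpha>B) (map_prod \<beta>A \<beta>B)"
proof -
  interpret A: bihom_jordan_algebra scaleA \<mu>A \<alpha>A \<beta>A by fact
  interpret B: bihom_jordan_algebra scaleB \<mu>B \<alpha>B \<beta>B by fact
  interpret P: multiplicative_bihom_algebra "module_prod.scale scaleA scaleB"
    "direct_sum_mult \<mu>A \<mu>B" "map_prod \<alpha>A \<alpha>B" "map_prod \<beta>A \<beta>B"
    by (intro multiplicative_bihom_algebra_direct_sum
        A.multiplicative_bihom_algebra_axioms B.multiplicative_bihom_algebra_axioms)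
  \<comment> \<open>The associator is a difference of iterated products twisted by \<alpha> and
    \<beta>, and subtraction of pairs is componentwise.\<close>
  have associator_Pair: "P.associator (a1, b1) (a2, b2) (a3, b3)
      = (A.associator a1 a2 a3, B.associator b1 b2 b3)" for a1 b1 a2 b2 a3 b3
    by (simp add: P.associator_def A.associator_def B.associator_def)
  show ?thesis
  proof
    fix x y :: "'a \<times> 'b"
    show "direct_sum_mult \<mu>A \<mu>B (map_prod \<beta>A \<beta>B x) (map_prod \<alpha>A \<alpha>B y)
        = direct_sum_mult \<mu>A \<mu>B (map_prod \<beta>A \<beta>B y) (map_prod \<alpha>A \<alpha>B x)"
      by (cases x; cases y)
        (auto intro: A.bihom_commutative B.bihom_commutative)
    show "P.associator
        (direct_sum_mult \<mu>A \<mu>B ((map_prod \<beta>A \<beta>B ^^ 2) x) (map_prod \<alpha>A \<alpha>B (map_prod \<beta>A \<beta>B x)))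
        ((map_prod \<alpha>A \<alpha>B ^^ 2) (map_prod \<beta>A \<beta>B y)) ((map_prod \<alpha>A \<alpha>B ^^ 3) x) = 0"
      by (cases x; cases y)
        (simp only: map_prod_funpow map_prod_simp direct_sum_mult_Pair associator_Pair
          A.bihom_jordan_identity B.bihom_jordan_identity zero_prod_def)
  qed
qed

end
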